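(* Let $c>0$, $\nu>0$, $\mu>0$, and let $N_0$ be a constant. Then the solution $N(t)$, $t>0$, of the equation $$N(t)-N_0\,t^{\mu-1}E_{\nu,\mu}(-c^{\nu}t^{\nu})=-c^{\nu}\;{}_0D_t^{-\nu}N(t)$$ is given by $$N(t)=\frac{N_0}{\nu}\,t^{\mu-1}\left[E_{\nu,\mu-1}(-c^{\nu}t^{\nu})+(1+\nu-\mu)\,E_{\nu,\mu}(-c^{\nu}t^{\nu})\right].$$
   Context: The Riemann-Liouville fractional integral of order $\nu>0$ with lower limit $0$ is ${}_0D_t^{-\nu}f(t)=\frac{1}{\Gamma(\nu)}\int_0^t f(u)(t-u)^{\nu-1}\,du$. The generalized Mittag-Leffler function is $E_{\alpha,\beta}(z)=\sum_{n=0}^{\infty}\frac{z^n}{\Gamma(\alpha n+\beta)}$ for $\alpha>0$ and real $\beta$, with the usual convention $1/\Gamma(x)=0$ when $x$ is a non-positive integer. The unknown $N$ is a real-valued function of $t>0$, locally integrable on $[0,\infty)$, and $N_0$ is a real constant. *)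

theory Defs
  imports "HOL-Analysis.Analysis"
begin

(* rGamma is the entire reciprocal of Gamma, hence 0 at the non-positive integers.
   For alpha > 0 the series converges for every z. *)
definition mittag_leffler :: "real \<Rightarrow> real \<Rightarrow> real \<Rightarrow> real" where
  "mittag_leffler \<alpha> \<beta> z = (\<Sum>n. z ^ n * rGamma (\<alpha> * real n + \<beta>))"

(* The integrand at the endpoint u = t is irrelevant (null set); there 0 powr a = 0. *)
definition rl_integrable :: "real \<Rightarrow> (real \<Rightarrow> real) \<Rightarrow> real \<Rightarrow> bool" where
  "rl_integrable \<nu> f t \<longleftrightarrow>
     set_integrable lebesgue {0..t} (\<lambda>u. f u * (t - u) powr (\<nu> - 1))"

definition rl_integral :: "real \<Rightarrow> (real \<Rightarrow> real) \<Rightarrow> real \<Rightarrow> real" where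
  "rl_integral \<nu> f t =
     1 / Gamma \<nu> * (LINT u:{0..t}|lebesgue. f u * (t - u) powr (\<nu> - 1))"

definition locally_integrable_nonneg :: "(real \<Rightarrow> real) \<Rightarrow> bool" where
  "locally_integrable_nonneg f \<longleftrightarrow> (\<forall>T>0. set_integrable lebesgue {0..T} f)"

(* Only the values of N on t > 0 matter: its value at 0 affects no integral below.
   For nu < 1 a locally integrable N has a convergent fractional integral only at almost every t,
   so that the equation makes sense at t is part of being a solution; otherwise the
   value of rl_integral would be the default 0 of the Bochner integral. *)
definition kinetic_solution ::
  "real \<Rightarrow> real \<Rightarrow> real \<Rightarrow> real \<Rightarrow> (real \<Rightarrow> real) \<Rightarrow> bool" where
  "kinetic_solution c \<nu> \<mu> N\<^sub>0 N \<longleftrightarrow>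
     locally_integrable_nonneg N \<and>
     (\<forall>t>0. rl_integrable \<nu> N t \<and>
        N t - N\<^sub>0 * t powr (\<mu> - 1) * mittag_leffler \<nu> \<mu> (- (c powr \<nu>) * t powr \<nu>)
          = - (c powr \<nu>) * rl_integral \<nu> N t)"

end

theory Submission
  imports Defs
begin

text \<open>
  Write \<open>a = c powr \<nu>\<close>, write \<open>I \<sigma>\<close> for fractional integration of order \<open>\<sigma>\<close>, and put
  \<open>h p t = t powr (p - 1) / \<Gamma>(p)\<close>.  The Beta integral gives \<open>I \<sigma> (h p) = h (p + \<sigma>)\<close>, so on the
  functions \<open>h (\<nu> k + \<mu>)\<close> the operator \<open>I \<nu>\<close> is the shift \<open>k \<mapsto> k + 1\<close>.  Hence the forcing term,
  which is \<open>N\<^sub>0 \<Sum> (- a) ^ k h (\<nu> k + \<mu>)\<close>, is the Neumann series of \<open>(1 + a I \<nu>)\<close> inverted once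
  on \<open>N\<^sub>0 h \<mu>\<close>.  Solving the equation inverts the operator a second time, and the expansion
  \<open>1 / (1 + x)\<^sup>2 = \<Sum> (k + 1) (- x) ^ k\<close> suggests the solution
  \<open>F = N\<^sub>0 \<Sum> (k + 1) (- a) ^ k h (\<nu> k + \<mu>)\<close>.
  The recurrence \<open>1 / \<Gamma>(x - 1) = (x - 1) / \<Gamma>(x)\<close>, used with \<open>x = \<nu> k + \<mu>\<close>, turns the factor
  \<open>k + 1\<close> into the bracket of two Mittag-Leffler functions
  (\<open>kinetic_series_eq_mittag_leffler\<close>).

  That \<open>F\<close> is a solution (\<open>kinetic_solution_series\<close>) requires \<open>I \<nu>\<close> to be applied term by term
  (\<open>rl_integral_sums\<close>).  This is dominated convergence, fed by the absolute convergence of all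
  series involved, which holds because \<open>\<Gamma>(y)\<close> grows faster than every exponential
  \<open>A powr y\<close>.  Local integrability of \<open>F\<close> is the case \<open>\<sigma> = 1\<close> of the same argument.

  For uniqueness (\<open>kinetic_solution_unique\<close>), the difference \<open>f\<close> of two solutions satisfies
  \<open>f = - a I \<nu> f\<close>.  By Tonelli, \<open>I \<nu>\<close> has norm at most \<open>l powr (- \<nu>)\<close> in the weighted norm
  \<open>\<integral> exp (- l t) \<bar>f t\<bar> dt\<close>, so for large \<open>l\<close> the map \<open>a I \<nu>\<close> is a contraction and
  \<open>f\<close> vanishes almost everywhere.  The equation holds at every \<open>t > 0\<close>, and its right-hand side
  does not see null sets, so \<open>f\<close> vanishes at every \<open>t > 0\<close>.
\<close>

section \<open>Fractional integrals of powers and of series of powers\<close>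

text \<open>With this normalization, fractional integration of order \<open>\<sigma>\<close> just adds \<open>\<sigma>\<close> to the index.\<close>
definition normalized_power :: "real \<Rightarrow> real \<Rightarrow> real" where
  "normalized_power p t = rGamma p * t powr (p - 1)"

lemma normalized_power_nonneg: "p > 0 \<Longrightarrow> 0 \<le> normalized_power p t"
  by (simp add: normalized_power_def rGamma_inverse_Gamma)

text \<open>Euler's Beta integral, transported from the unit interval by \<open>u = t x\<close>.\<close>
lemma has_integral_powr_convolution:
  fixes p q t :: real
  assumes "p > 0" "q > 0" "t > 0"
  shows "((\<lambda>u. u powr (p - 1) * (t - u) powr (q - 1)) has_integral
            t powr (p + q - 1) * Beta p q) {0..t}"
proof -
  have "((\<lambda>u. (u / t) powr (p - 1) * (1 - u / t) powr (q - 1)) has_integral t * Beta p q) {0..t}"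
    using has_integral_affinity'[of _ _ 0 1 "1 / t" 0, OF has_integral_Beta_real[OF assms(1,2), folded cbox_interval]] assms
    by (simp add: field_simps)
  then have "((\<lambda>u. t powr (p + q - 2) * ((u / t) powr (p - 1) * (1 - u / t) powr (q - 1))) 
      has_integral t powr (p + q - 2) * (t * Beta p q)) {0..t}"
    by (rule has_integral_mult_right)
  moreover have "t powr (p + q - 2) * ((u / t) powr (p - 1) * (1 - u / t) powr (q - 1))
      = u powr (p - 1) * (t - u) powr (q - 1)" if "u \<in> {0..t}" for u
  proof -
    have "1 - u / t = (t - u) / t" using assms by (simp add: field_simps)
    moreover have "t powr (p + q - 2) = t powr (p - 1) * t powr (q - 1)"
      by (simp flip: powr_add)
    ultimately show ?thesis using that assms by (simp add: powr_divide)
  qed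
  moreover have "t powr (p + q - 2) * (t * Beta p q) = t powr (p + q - 1) * Beta p q"
    using assms powr_add[of t "p + q - 2" 1] by simp
  ultimately show ?thesis
    by (metis (no_types, lifting) has_integral_eq)
qed

lemma rl_normalized_power:
  assumes "p > 0" "\<sigma> > 0" "t > 0"
  shows "rl_integrable \<sigma> (normalized_power p) t"
    and "rl_integral \<sigma> (normalized_power p) t = normalized_power (p + \<sigma>) t"
proof -
  have I: "((\<lambda>u. normalized_power p u * (t - u) powr (\<sigma> - 1)) has_integral
      Gamma \<sigma> * normalized_power (p + \<sigma>) t) {0..t}"
    using has_integral_mult_right[OF has_integral_powr_convolution[OF assms], of "rGamma p"]
      Gamma_real_pos[OF assms(1)]
    by (simp add: normalized_power_def Beta_def rGamma_inverse_Gamma field_simps)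
  show *: "rl_integrable \<sigma> (normalized_power p) t"
    unfolding rl_integrable_def
    by (rule nonnegative_absolutely_integrable_1)
       (use I assms in \<open>auto simp: normalized_power_nonneg integrable_on_def\<close>)
  show "rl_integral \<sigma> (normalized_power p) t = normalized_power (p + \<sigma>) t"
    using set_lebesgue_integral_eq_integral(2)[OF *[unfolded rl_integrable_def]] integral_unique[OF I]
      Gamma_real_pos[OF assms(2)]
    by (simp add: rl_integral_def)
qed

text \<open>
  All terms apart from the \<open>b k\<close> are nonnegative, so the integrals of the absolute values are again
  normalized powers, and summability at the raised index \<open>p k + \<sigma>\<close> is exactly what dominated
  convergence asks for.  The function \<open>F\<close> is only prescribed for positive arguments, since its
  value at 0 cannot influence an integral.
\<close>
lemma rl_integral_sums:
  fixes b p :: "nat \<Rightarrow> real"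
  assumes \<sigma>: "\<sigma> > 0" and t: "t > 0" and p: "\<And>k. p k > 0"
    and summ: "\<And>u. u > 0 \<Longrightarrow> summable (\<lambda>k. \<bar>b k\<bar> * normalized_power (p k) u)"
    and summ_\<sigma>: "summable (\<lambda>k. \<bar>b k\<bar> * normalized_power (p k + \<sigma>) t)"
    and F: "\<And>u. u > 0 \<Longrightarrow> F u = (\<Sum>k. b k * normalized_power (p k) u)"
  shows "rl_integrable \<sigma> F t"
    and "(\<lambda>k. b k * normalized_power (p k + \<sigma>) t) sums rl_integral \<sigma> F t"
proof -
  define g where "g k u = indicator {0..t} u * (normalized_power (p k) u * (t - u) powr (\<sigma> - 1))" for k u
  have g_int: "integrable lebesgue (g k)" for k
    using rl_normalized_power(1)[OF p \<sigma> t, of k]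
    by (simp add: rl_integrable_def set_integrable_def g_def[abs_def])
  have g_val: "(\<integral>u. g k u \<partial>lebesgue) = Gamma \<sigma> * normalized_power (p k + \<sigma>) t" for k
    using rl_normalized_power(2)[OF p \<sigma> t, of k] Gamma_real_pos[OF \<sigma>]
    by (simp add: rl_integral_def set_lebesgue_integral_def g_def field_simps)
  have g_nonneg: "0 \<le> g k u" for k u
    by (simp add: g_def normalized_power_nonneg p)
  have ae: "AE u in lebesgue. u \<noteq> (0::real)"
    by (rule AE_completion) (rule AE_lborel_singleton)
  have i: "integrable lebesgue (\<lambda>u. b k * g k u)" for k
    using g_int by simp
  have ii: "AE u in lebesgue. summable (\<lambda>k. norm (b k * g k u))"
    using ae
  proof eventually_elim
    case (elim u)
    show ?case
    proof (cases "u \<in> {0..t}")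
      case True
      then have "u > 0" using elim by simp
      from summable_mult2[OF summ[OF this], of "(t - u) powr (\<sigma> - 1)"] True
      show ?thesis
        by (simp add: g_def abs_mult normalized_power_nonneg p mult.assoc)
    qed (simp add: g_def)
  qed
  have iii: "summable (\<lambda>k. \<integral>u. norm (b k * g k u) \<partial>lebesgue)"
    using summable_mult[OF summ_\<sigma>, of "Gamma \<sigma>"] g_nonneg
    by (simp add: abs_mult g_val mult_ac)
  have eq: "(\<Sum>k. b k * g k u) = indicator {0..t} u * (F u * (t - u) powr (\<sigma> - 1))" if "u \<noteq> 0" for u
  proof (cases "u \<in> {0..t}")
    case True
    then have "u > 0" using that by simp
    have "summable (\<lambda>k. b k * normalized_power (p k) u)"
      by (rule summable_rabs_cancel) (use summ[OF \<open>u > 0\<close>] in \<open>simp add: abs_mult normalized_power_nonneg p\<close>)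
    then show ?thesis using True suminf_mult2[of "\<lambda>k. b k * normalized_power (p k) u" "(t - u) powr (\<sigma> - 1)"]
      by (simp add: F[OF \<open>u > 0\<close>] g_def mult.assoc)
  qed (simp add: g_def)
  note int = integrable_suminf[OF i ii iii] and sums = sums_integral[OF i ii iii]
  \<comment> \<open>Altering the measurable sum at the single point 0 yields the integrand.\<close>
  have "(\<lambda>u. if u = 0 then F 0 * t powr (\<sigma> - 1) else (\<Sum>k. b k * g k u)) \<in> borel_measurable lebesgue"
    using int by (intro measurable_If) auto
  also have "(\<lambda>u. if u = 0 then F 0 * t powr (\<sigma> - 1) else (\<Sum>k. b k * g k u)) =
      (\<lambda>u. indicator {0..t} u * (F u * (t - u) powr (\<sigma> - 1)))"
    using t by (auto simp: eq)
  finally have meas: "(\<lambda>u. indicator {0..t} u * (F u * (t - u) powr (\<sigma> - 1))) \<in> borel_measurable lebesgue" .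
  have eq_ae: "AE u in lebesgue. (\<Sum>k. b k * g k u) = indicator {0..t} u * (F u * (t - u) powr (\<sigma> - 1))"
    using ae by eventually_elim (rule eq)
  have int': "integrable lebesgue (\<lambda>u. indicator {0..t} u * (F u * (t - u) powr (\<sigma> - 1)))"
    by (rule integrable_cong_AE_imp[OF int meas eq_ae])
  show "rl_integrable \<sigma> F t"
    using int' by (simp add: rl_integrable_def set_integrable_def)
  have "(\<integral>u. (\<Sum>k. b k * g k u) \<partial>lebesgue) = Gamma \<sigma> * rl_integral \<sigma> F t"
    using integral_cong_AE[OF _ _ eq_ae] int meas Gamma_real_pos[OF \<sigma>]
    by (simp add: rl_integral_def set_lebesgue_integral_def borel_measurable_integrable)
  with sums have "(\<lambda>k. Gamma \<sigma> * (b k * normalized_power (p k + \<sigma>) t)) sums (Gamma \<sigma> * rl_integral \<sigma> F t)"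
    by (simp add: g_val mult_ac)
  then show "(\<lambda>k. b k * normalized_power (p k + \<sigma>) t) sums rl_integral \<sigma> F t"
    using Gamma_real_pos[OF \<sigma>] by (simp add: sums_mult_iff)
qed


section \<open>Convergence of the Mittag-Leffler series\<close>

text \<open>
  Keep only the part of Euler's integral over \<open>[A, A + 1]\<close>.  As \<open>A\<close> is arbitrary, this shows that
  \<open>Gamma\<close> outgrows every exponential.
\<close>
lemma Gamma_real_lower_bound:
  fixes y A :: real
  assumes "y \<ge> 1" "A > 0"
  shows "A powr (y - 1) * exp (- (A + 1)) \<le> Gamma y"
proof -
  have G: "((\<lambda>t. t powr (y - 1) / exp t) has_integral Gamma y) {0..}"
    using Gamma_integral_real assms by simp
  have "(\<lambda>t. t powr (y - 1) / exp t) absolutely_integrable_on {0..}"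
    by (rule nonnegative_absolutely_integrable_1) (use G in \<open>auto simp: integrable_on_def\<close>)
  then have "(\<lambda>t. t powr (y - 1) / exp t) absolutely_integrable_on {A..A + 1}"
    by (rule set_integrable_subset) (use assms in auto)
  then have i: "(\<lambda>t. t powr (y - 1) / exp t) integrable_on {A..A + 1}"
    by (rule set_lebesgue_integral_eq_integral(1))
  have "integral {A..A + 1} (\<lambda>t. A powr (y - 1) * exp (- (A + 1))) \<le> integral {A..A + 1} (\<lambda>t. t powr (y - 1) / exp t)"
  proof (rule integral_le[OF _ i])
    fix t assume t: "t \<in> {A..A + 1}"
    have "A powr (y - 1) * exp (- (A + 1)) \<le> t powr (y - 1) * exp (- t)"
      using t assms by (intro mult_mono powr_mono2) auto
    then show "A powr (y - 1) * exp (- (A + 1)) \<le> t powr (y - 1) / exp t"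
      by (simp add: exp_minus field_simps)
  qed auto
  also have "\<dots> \<le> integral {0..} (\<lambda>t. t powr (y - 1) / exp t)"
    by (rule integral_subset_le) (use i G assms in \<open>auto simp: integrable_on_def\<close>)
  finally show ?thesis using integral_unique[OF G] by simp
qed

lemma summable_power_rGamma:
  fixes \<nu> \<mu> x :: real
  assumes "\<nu> > 0" "\<mu> > 0" "x \<ge> 0"
  shows "summable (\<lambda>k. x ^ k * rGamma (\<nu> * real k + \<mu>))"
proof -
  \<comment> \<open>This base makes the terms comparable to a geometric series of ratio \<open>x / (2 * x + 1)\<close>,
      and the summand 1 keeps it positive for \<open>x = 0\<close>.\<close>
  define A where "A = (2 * x + 1) powr (1 / \<nu>)"
  have A: "A > 0" "A powr \<nu> = 2 * x + 1"
    using assms by (auto simp: A_def powr_powr)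
  define C where "C = exp (A + 1) * A powr (1 - \<mu>)"
  have ratio: "x / (2 * x + 1) < 1" "0 \<le> x / (2 * x + 1)" using assms by (auto simp: field_simps)
  show ?thesis
  proof (rule summable_comparison_test_ev)
    have "eventually (\<lambda>k. \<nu> * real k + \<mu> \<ge> 1) sequentially"
    proof -
      have "eventually (\<lambda>k. real k \<ge> 1 / \<nu>) sequentially"
        by (rule eventually_sequentiallyI[of "nat \<lceil>1 / \<nu>\<rceil>"]) (use assms in linarith)
      then show ?thesis
        by eventually_elim (use assms in \<open>simp add: field_simps\<close>)
    qed
    then show "eventually (\<lambda>k. norm (x ^ k * rGamma (\<nu> * real k + \<mu>)) \<le> C * (x / (2 * x + 1)) ^ k) sequentially"
    proof eventually_elim
      case (elim k)
      have "A powr (\<nu> * real k + \<mu> - 1) = (2 * x + 1) ^ k * A powr (\<mu> - 1)"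
        using A assms by (simp add: add_diff_eq[symmetric] powr_add powr_realpow flip: powr_powr)
      with Gamma_real_lower_bound[OF elim A(1)]
      have L: "(2 * x + 1) ^ k * A powr (\<mu> - 1) * exp (- (A + 1)) \<le> Gamma (\<nu> * real k + \<mu>)" by simp
      have "rGamma (\<nu> * real k + \<mu>) \<le> inverse ((2 * x + 1) ^ k * A powr (\<mu> - 1) * exp (- (A + 1)))"
        unfolding rGamma_inverse_Gamma by (rule le_imp_inverse_le[OF L]) (use A assms in auto)
      also have "\<dots> = C * inverse ((2 * x + 1) ^ k)"
        using A powr_minus[of A "\<mu> - 1"] exp_minus[of "A + 1"]
        by (simp add: C_def del: minus_add_distrib)
      finally have "x ^ k * rGamma (\<nu> * real k + \<mu>) \<le> x ^ k * (C * inverse ((2 * x + 1) ^ k))"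
        by (rule mult_left_mono) (use assms in auto)
      moreover have "rGamma (\<nu> * real k + \<mu>) \<ge> 0" using elim by (simp add: rGamma_inverse_Gamma)
      ultimately show ?case using assms
        by (simp add: power_divide field_simps)
    qed
    show "summable (\<lambda>k. C * (x / (2 * x + 1)) ^ k)"
      using ratio by (intro summable_mult summable_geometric) (simp only: real_norm_def abs_of_nonneg)
  qed
qed

section \<open>Uniqueness for the homogeneous equation\<close>

text \<open>
  The Laplace transform of the kernel \<open>t powr (\<nu> - 1)\<close>, shifted by \<open>u\<close>; substituting
  \<open>t = u + x / l\<close> reduces it to Euler's integral.
\<close>
lemma nn_integral_exp_kernel:
  fixes \<nu> l u :: real
  assumes "\<nu> > 0" "l > 0"
  shows "(\<integral>\<^sup>+t. ennreal (exp (- l * t)) * ennreal (indicator {u..} t * (t - u) powr (\<nu> - 1)) \<partial>lborel)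
    = ennreal (Gamma \<nu> * l powr - \<nu>) * ennreal (exp (- l * u))"
proof -
  define K where "K = exp (- l * u) * l powr (1 - \<nu>)"
  have K: "K \<ge> 0" by (simp add: K_def)
  have "(\<integral>\<^sup>+t. ennreal (exp (- l * t)) * ennreal (indicator {u..} t * (t - u) powr (\<nu> - 1)) \<partial>lborel)
     = ennreal \<bar>1 / l\<bar> * (\<integral>\<^sup>+x. ennreal (exp (- l * (u + 1 / l * x))) * 
         ennreal (indicator {u..} (u + 1 / l * x) * ((u + 1 / l * x) - u) powr (\<nu> - 1)) \<partial>lborel)"
    using assms by (intro nn_integral_real_affine) auto
  also have "(\<lambda>x. ennreal (exp (- l * (u + 1 / l * x))) * 
         ennreal (indicator {u..} (u + 1 / l * x) * ((u + 1 / l * x) - u) powr (\<nu> - 1)))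
      = (\<lambda>x. ennreal K * ennreal (indicator {0..} x * x powr (\<nu> - 1) / exp x))"
  proof
    fix x :: real
    show "ennreal (exp (- l * (u + 1 / l * x))) * 
         ennreal (indicator {u..} (u + 1 / l * x) * ((u + 1 / l * x) - u) powr (\<nu> - 1))
       = ennreal K * ennreal (indicator {0..} x * x powr (\<nu> - 1) / exp x)"
    proof (cases "x \<ge> 0")
      case True
      have "exp (- l * (u + 1 / l * x)) * (x / l) powr (\<nu> - 1) = K * (x powr (\<nu> - 1) / exp x)"
      proof -
        have "- l * (u + 1 / l * x) = - l * u - x" using assms by (simp add: field_simps)
        moreover have "(x / l) powr (\<nu> - 1) = x powr (\<nu> - 1) * l powr (1 - \<nu>)"
          using True assms powr_minus[of l "\<nu> - 1"] by (simp add: powr_divide) (simp add: divide_inverse)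
        ultimately show ?thesis by (simp add: K_def exp_diff)
      qed
      with True show ?thesis using assms K by (simp flip: ennreal_mult)
    qed (use assms in \<open>auto simp: indicator_def zero_le_divide_iff\<close>)
  qed
  also have "(\<integral>\<^sup>+x. ennreal K * ennreal (indicator {0..} x * x powr (\<nu> - 1) / exp x) \<partial>lborel) = 
     ennreal K * ennreal (Gamma \<nu>)"
    using assms by (subst nn_integral_cmult) (auto simp: Gamma_conv_nn_integral_real)
  also have "ennreal \<bar>1 / l\<bar> * (ennreal K * ennreal (Gamma \<nu>)) = ennreal (1 / l * (K * Gamma \<nu>))"
    using assms K by (simp flip: ennreal_mult)
  also have "1 / l * (K * Gamma \<nu>) = (Gamma \<nu> * l powr - \<nu>) * exp (- l * u)"
    using assms powr_add[of l "1" "- \<nu>"] by (simp add: K_def)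
  finally show ?thesis using assms by (simp add: ennreal_mult)
qed

text \<open>
  Multiplying the inequality by \<open>exp (- l * t)\<close> and integrating, Tonelli's theorem bounds the
  weighted integral of \<open>g\<close> by a factor smaller than 1 times itself.  As it is finite, it is 0.
\<close>
lemma AE_zero_if_le_convolution:
  fixes g :: "real \<Rightarrow> ennreal" and C \<nu> l :: real
  assumes [measurable]: "g \<in> borel_measurable borel"
    and "\<nu> > 0" "l > 0" "C \<ge> 0"
    and le: "AE t in lborel. g t \<le> ennreal C *
      (\<integral>\<^sup>+u. g u * ennreal (indicator {u..} t * (t - u) powr (\<nu> - 1)) \<partial>lborel)"
    and fin: "(\<integral>\<^sup>+t. ennreal (exp (- l * t)) * g t \<partial>lborel) < \<infinity>"
    and small: "C * (Gamma \<nu> * l powr - \<nu>) < 1"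
  shows "AE t in lborel. g t = 0"
proof -
  define A where "A = (\<integral>\<^sup>+t. ennreal (exp (- l * t)) * g t \<partial>lborel)"
  define k where "k = (\<lambda>u t. ennreal (indicator {u..} t * (t - u) powr (\<nu> - 1)))"
  \<comment> \<open>In this form the joint measurability of the kernel is found automatically.\<close>
  have k_alt: "k = (\<lambda>u t. if u \<le> t then ennreal ((t - u) powr (\<nu> - 1)) else 0)"
    by (auto simp: k_def fun_eq_iff)
  have k_meas[measurable]: "(\<lambda>(u, t). k u t) \<in> borel_measurable (borel \<Otimes>\<^sub>M borel)"
    unfolding k_alt by measurable
  have "A \<le> (\<integral>\<^sup>+t. (\<integral>\<^sup>+u. ennreal C * (ennreal (exp (- l * t)) * (g u * k u t)) \<partial>lborel) \<partial>lborel)"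
    unfolding A_def
  proof (rule nn_integral_mono_AE)
    show "AE t in lborel. ennreal (exp (- l * t)) * g t \<le> (\<integral>\<^sup>+u. ennreal C * (ennreal (exp (- l * t)) * (g u * k u t)) \<partial>lborel)"
      using le
    proof eventually_elim
      case (elim t)
      have "ennreal (exp (- l * t)) * g t \<le> ennreal (exp (- l * t)) * (ennreal C * (\<integral>\<^sup>+u. g u * k u t \<partial>lborel))"
        using elim unfolding k_def by (rule mult_left_mono) simp
      also have "\<dots> = (\<integral>\<^sup>+u. ennreal C * (ennreal (exp (- l * t)) * (g u * k u t)) \<partial>lborel)"
        by (subst nn_integral_cmult, simp)+ (simp add: mult_ac)
      finally show ?case .
    qed
  qed
  also have "\<dots> = (\<integral>\<^sup>+u. (\<integral>\<^sup>+t. ennreal C * (ennreal (exp (- l * t)) * (g u * k u t)) \<partial>lborel) \<partial>lborel)"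
    by (rule lborel_pair.Fubini') simp
  also have "\<dots> = (\<integral>\<^sup>+u. (ennreal C * ennreal (Gamma \<nu> * l powr - \<nu>)) * (ennreal (exp (- l * u)) * g u) \<partial>lborel)"
  proof (rule nn_integral_cong)
    fix u
    have "(\<integral>\<^sup>+t. ennreal C * (ennreal (exp (- l * t)) * (g u * k u t)) \<partial>lborel)
        = (\<integral>\<^sup>+t. (ennreal C * g u) * (ennreal (exp (- l * t)) * k u t) \<partial>lborel)"
      by (simp add: mult_ac)
    also have "\<dots> = (ennreal C * g u) * (\<integral>\<^sup>+t. ennreal (exp (- l * t)) * k u t \<partial>lborel)"
      by (rule nn_integral_cmult) simp
    also have "\<dots> = (ennreal C * ennreal (Gamma \<nu> * l powr - \<nu>)) * (ennreal (exp (- l * u)) * g u)"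
      using nn_integral_exp_kernel[OF assms(2,3), of u] by (simp add: k_def mult_ac)
    finally show "(\<integral>\<^sup>+t. ennreal C * (ennreal (exp (- l * t)) * (g u * k u t)) \<partial>lborel) = \<dots>" .
  qed
  also have "\<dots> = ennreal C * ennreal (Gamma \<nu> * l powr - \<nu>) * A"
    unfolding A_def by (rule nn_integral_cmult) simp
  also have "\<dots> = ennreal (C * (Gamma \<nu> * l powr - \<nu>)) * A"
    using assms by (simp add: ennreal_mult)
  finally have le_A: "A \<le> ennreal (C * (Gamma \<nu> * l powr - \<nu>)) * A" .
  obtain a where a: "A = ennreal a" "a \<ge> 0"
    using fin unfolding A_def[symmetric] by (cases A) auto
  have "a \<le> C * (Gamma \<nu> * l powr - \<nu>) * a"
    using le_A a assms by (simp flip: ennreal_mult)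
  moreover have "C * (Gamma \<nu> * l powr - \<nu>) * a < 1 * a" if "a > 0"
    using small that by (rule mult_strict_right_mono)
  ultimately have "A = 0" using a by fastforce
  then have "AE t in lborel. ennreal (exp (- l * t)) * g t = 0"
    unfolding A_def by (subst (asm) nn_integral_0_iff_AE) auto
  then show ?thesis by eventually_elim simp
qed

text \<open>
  The function \<open>\<bar>f\<bar>\<close> restricted to \<open>[0, T]\<close> satisfies the hypotheses of the previous lemma, except
  that it is only Lebesgue measurable; it is replaced by a Borel function equal to it almost
  everywhere.  The equation at \<open>T\<close> then improves the resulting vanishing almost everywhere to
  vanishing at \<open>T\<close>.
\<close>
lemma volterra_unique:
  fixes a \<nu> :: real and f :: "real \<Rightarrow> real"
  assumes a: "a > 0" and \<nu>: "\<nu> > 0"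
    and loc: "locally_integrable_nonneg f"
    and int: "\<And>t. t > 0 \<Longrightarrow> rl_integrable \<nu> f t"
    and eq: "\<And>t. t > 0 \<Longrightarrow> f t = - a * rl_integral \<nu> f t"
    and T: "T > 0"
  shows "f T = 0"
proof -
  define h where "h t = ennreal (indicator {0..T} t * \<bar>f t\<bar>)" for t
  define k where "k = (\<lambda>u t. ennreal (indicator {u..} t * (t - u) powr (\<nu> - 1)))"
  define C where "C = a / Gamma \<nu>"
  \<comment> \<open>Chosen so that the contraction factor \<open>a * l powr - \<nu>\<close> is 1/2.\<close>
  define l where "l = (2 * a) powr (1 / \<nu>)"
  have G: "Gamma \<nu> > 0" using \<nu> by simp
  have l: "l > 0" "l powr - \<nu> = 1 / (2 * a)" using a \<nu> by (auto simp: l_def powr_powr powr_minus_divide)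
  have C: "C \<ge> 0" using a G by (simp add: C_def)
  have f_int: "integrable lebesgue (\<lambda>t. indicator {0..T} t * f t)"
    using loc T by (simp add: locally_integrable_nonneg_def set_integrable_def)
  then have "integrable lebesgue (\<lambda>t. \<bar>indicator {0..T} t * f t\<bar>)" by (rule integrable_abs)
  then have absf_int: "integrable lebesgue (\<lambda>t. indicator {0..T} t * \<bar>f t\<bar>)" by (simp add: abs_mult)
  have h_meas: "h \<in> borel_measurable lebesgue"
    unfolding h_def using absf_int by auto
  obtain g where g[measurable]: "g \<in> borel_measurable borel" and hg: "AE t in lborel. h t = g t"
    using completion_ex_borel_measurable[OF h_meas] by auto
  have h_le: "h t \<le> ennreal C * (\<integral>\<^sup>+u. h u * k u t \<partial>lborel)" if "t \<noteq> 0" for t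
  proof (cases "t \<in> {0..T}")
    case True
    then have t: "0 < t" "t \<le> T" using that by auto
    have i: "integrable lebesgue (\<lambda>u. indicator {0..t} u * (f u * (t - u) powr (\<nu> - 1)))"
      using int[OF t(1)] by (simp add: rl_integrable_def set_integrable_def)
    have "h t = ennreal \<bar>f t\<bar>" using True by (simp add: h_def)
    also have "\<dots> = ennreal (C * \<bar>\<integral>u. indicator {0..t} u * (f u * (t - u) powr (\<nu> - 1)) \<partial>lebesgue\<bar>)"
      using a G by (subst eq[OF t(1)]) (simp add: C_def rl_integral_def set_lebesgue_integral_def abs_mult)
    also have "\<dots> \<le> ennreal C * (\<integral>\<^sup>+u. norm (indicator {0..t} u * (f u * (t - u) powr (\<nu> - 1))) \<partial>lebesgue)"
      using integral_norm_bound_ennreal[OF i] C by (simp add: ennreal_mult mult_left_mono)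
    also have "(\<integral>\<^sup>+u. norm (indicator {0..t} u * (f u * (t - u) powr (\<nu> - 1))) \<partial>lebesgue) =
        (\<integral>\<^sup>+u. h u * k u t \<partial>lebesgue)"
      using t by (intro nn_integral_cong) (auto simp: h_def k_def indicator_def abs_mult simp flip: ennreal_mult)
    finally show ?thesis by (simp add: nn_integral_completion)
  qed (simp add: h_def)
  have "AE t in lborel. g t = 0"
  proof (rule AE_zero_if_le_convolution[OF g \<nu> l(1) C])
    have *: "(\<integral>\<^sup>+u. h u * k u t \<partial>lborel) = (\<integral>\<^sup>+u. g u * k u t \<partial>lborel)" for t
      by (rule nn_integral_cong_AE) (use hg in auto)
    have "AE t in lborel. t \<noteq> (0::real)" by (rule AE_lborel_singleton)
    with hg show "AE t in lborel. g t \<le> ennreal C * (\<integral>\<^sup>+u. g u * ennreal (indicator {u..} t * (t - u) powr (\<nu> - 1)) \<partial>lborel)"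
    proof eventually_elim
      case (elim t)
      then have "g t \<le> ennreal C * (\<integral>\<^sup>+u. g u * k u t \<partial>lborel)"
        using h_le[of t] by (simp add: *)
      then show ?case by (simp add: k_def)
    qed
    have "(\<integral>\<^sup>+t. ennreal (exp (- l * t)) * g t \<partial>lborel) = (\<integral>\<^sup>+t. ennreal (exp (- l * t)) * h t \<partial>lborel)"
      by (rule nn_integral_cong_AE) (use hg in auto)
    also have "\<dots> \<le> (\<integral>\<^sup>+t. h t \<partial>lborel)"
    proof (rule nn_integral_mono)
      fix t
      have "exp (- l * t) \<le> 1 \<or> h t = 0"
        using l by (cases "t \<ge> 0") (auto simp: h_def)
      then show "ennreal (exp (- l * t)) * h t \<le> h t"
        using mult_right_mono[of "ennreal (exp (- l * t))" 1 "h t"] by auto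
    qed
    also have "\<dots> = (\<integral>\<^sup>+t. h t \<partial>lebesgue)" by (simp add: nn_integral_completion)
    also have "\<dots> < \<infinity>"
      unfolding h_def using absf_int by (subst nn_integral_eq_integral) auto
    finally show "(\<integral>\<^sup>+t. ennreal (exp (- l * t)) * g t \<partial>lborel) < \<infinity>" .
    show "C * (Gamma \<nu> * l powr - \<nu>) < 1"
      using a G by (simp add: C_def l)
  qed
  with hg have "AE t in lborel. h t = 0" by eventually_elim simp
  then have "AE t in lebesgue. h t = 0" by (rule AE_completion)
  then have "AE u in lebesgue. indicator {0..T} u * (f u * (T - u) powr (\<nu> - 1)) = 0"
    by eventually_elim (auto simp: h_def indicator_def split: if_splits)
  then have "(\<integral>u. indicator {0..T} u * (f u * (T - u) powr (\<nu> - 1)) \<partial>lebesgue) = 0"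
    by (rule integral_eq_zero_AE)
  then have "rl_integral \<nu> f T = 0"
    by (simp add: rl_integral_def set_lebesgue_integral_def)
  then show "f T = 0" using eq[OF T] by simp
qed


section \<open>The series solution and its closed form\<close>
lemma normalized_power_arith_progression:
  "t > 0 \<Longrightarrow> normalized_power (\<nu> * real k + \<mu>) t = t powr (\<mu> - 1) * ((t powr \<nu>) ^ k * rGamma (\<nu> * real k + \<mu>))"
proof -
  assume "t > 0"
  have "t powr (\<nu> * real k + \<mu> - 1) = t powr (\<mu> - 1) * t powr (\<nu> * real k)"
    by (simp flip: powr_add add: algebra_simps)
  also have "t powr (\<nu> * real k) = (t powr \<nu>) ^ k"
    using \<open>t > 0\<close> by (simp add: powr_realpow flip: powr_powr)
  finally show ?thesis by (simp add: normalized_power_def)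
qed

text \<open>The factor \<open>k + 1\<close> is harmless because it is at most \<open>2 ^ k\<close>, which only doubles \<open>x\<close>.\<close>
lemma summable_linear_power_rGamma:
  fixes \<nu> \<mu> x :: real
  assumes "\<nu> > 0" "\<mu> > 0" "x \<ge> 0"
  shows "summable (\<lambda>k. (real k + 1) * (x ^ k * rGamma (\<nu> * real k + \<mu>)))"
proof (rule summable_comparison_test')
  show "summable (\<lambda>k. (2 * x) ^ k * rGamma (\<nu> * real k + \<mu>))"
    using assms by (intro summable_power_rGamma) auto
  fix k :: nat
  have "\<nu> * real k + \<mu> > 0" using assms by (simp add: add_nonneg_pos)
  then have G: "rGamma (\<nu> * real k + \<mu>) \<ge> 0" by (simp add: rGamma_inverse_Gamma)
  have "k + 1 \<le> 2 ^ k" by (induction k) auto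
  then have "real (k + 1) \<le> real (2 ^ k)" by (rule of_nat_mono)
  then have k: "real k + 1 \<le> 2 ^ k" by simp
  have "(real k + 1) * (x ^ k * rGamma (\<nu> * real k + \<mu>)) \<le> 2 ^ k * (x ^ k * rGamma (\<nu> * real k + \<mu>))"
    using k G assms by (intro mult_right_mono) auto
  then show "norm ((real k + 1) * (x ^ k * rGamma (\<nu> * real k + \<mu>))) \<le> (2 * x) ^ k * rGamma (\<nu> * real k + \<mu>)"
    using G assms by (simp add: power_mult_distrib mult_ac)
qed

lemma summable_rGamma_series:
  fixes \<nu> \<mu> z :: real
  assumes "\<nu> > 0" "\<mu> > 0"
  shows "summable (\<lambda>k. z ^ k * rGamma (\<nu> * real k + \<mu>))"
    and "summable (\<lambda>k. (real k + 1) * (z ^ k * rGamma (\<nu> * real k + \<mu>)))"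
proof -
  have G: "\<bar>rGamma (\<nu> * real k + \<mu>)\<bar> = rGamma (\<nu> * real k + \<mu>)" for k
  proof -
    have "\<nu> * real k + \<mu> > 0" using assms by (simp add: add_nonneg_pos)
    then show ?thesis by (simp add: rGamma_inverse_Gamma)
  qed
  show "summable (\<lambda>k. z ^ k * rGamma (\<nu> * real k + \<mu>))"
    by (rule summable_rabs_cancel)
      (use summable_power_rGamma[OF assms, of "\<bar>z\<bar>"] in \<open>simp add: abs_mult power_abs G\<close>)
  show "summable (\<lambda>k. (real k + 1) * (z ^ k * rGamma (\<nu> * real k + \<mu>)))"
    by (rule summable_rabs_cancel)
      (use summable_linear_power_rGamma[OF assms, of "\<bar>z\<bar>"] in \<open>simp add: abs_mult power_abs G\<close>)
qed

text \<open>
  The recurrence \<open>rGamma (x - 1) = (x - 1) * rGamma x\<close> lets the series with parameter \<open>\<mu> - 1\<close> be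
  written through the one with parameter \<open>\<mu>\<close>, and
  \<open>(\<nu> * k + \<mu> - 1) + (1 + \<nu> - \<mu>) = \<nu> * (k + 1)\<close>.  The recurrence persists where
  \<open>Gamma\<close> has a pole, so the term \<open>k = 0\<close> needs no case distinction when \<open>\<mu> = 1\<close>.
\<close>
lemma mittag_leffler_combination:
  fixes \<nu> \<mu> z :: real
  assumes "\<nu> > 0" "\<mu> > 0"
  shows "mittag_leffler \<nu> (\<mu> - 1) z + (1 + \<nu> - \<mu>) * mittag_leffler \<nu> \<mu> z
     = \<nu> * (\<Sum>k. (real k + 1) * (z ^ k * rGamma (\<nu> * real k + \<mu>)))"
proof -
  let ?r = "\<lambda>k. z ^ k * rGamma (\<nu> * real k + \<mu>)"
  have A: "?r sums mittag_leffler \<nu> \<mu> z"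
    using summable_rGamma_series(1)[OF assms, of z] by (simp add: mittag_leffler_def summable_sums)
  have B: "(\<lambda>k. (real k + 1) * ?r k) sums (\<Sum>k. (real k + 1) * ?r k)"
    using summable_rGamma_series(2)[OF assms, of z] by (rule summable_sums)
  have "(\<lambda>k. \<nu> * ((real k + 1) * ?r k) - (1 + \<nu> - \<mu>) * ?r k)
      sums (\<nu> * (\<Sum>k. (real k + 1) * ?r k) - (1 + \<nu> - \<mu>) * mittag_leffler \<nu> \<mu> z)"
    by (intro sums_diff sums_mult A B)
  also have "(\<lambda>k. \<nu> * ((real k + 1) * ?r k) - (1 + \<nu> - \<mu>) * ?r k)
      = (\<lambda>k. z ^ k * rGamma (\<nu> * real k + (\<mu> - 1)))"
  proof
    fix k
    have "rGamma (\<nu> * real k + (\<mu> - 1)) = (\<nu> * real k + (\<mu> - 1)) * rGamma (\<nu> * real k + \<mu>)"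
      using rGamma_plus1[of "\<nu> * real k + (\<mu> - 1)"] by simp
    then show "\<nu> * ((real k + 1) * ?r k) - (1 + \<nu> - \<mu>) * ?r k = z ^ k * rGamma (\<nu> * real k + (\<mu> - 1))"
      by (simp only:) (simp add: algebra_simps)
  qed
  finally show ?thesis
    by (simp add: mittag_leffler_def sums_iff)
qed

text \<open>
  The expansion of \<open>(1 + a I)\<close> inverted twice on \<open>N\<^sub>0\<close> times the normalized power of index \<open>\<mu>\<close>,
  where \<open>I\<close> is fractional integration of order \<open>\<nu>\<close> and \<open>a = c powr \<nu>\<close>.
\<close>
definition kinetic_series :: "real \<Rightarrow> real \<Rightarrow> real \<Rightarrow> real \<Rightarrow> real \<Rightarrow> real" where
  "kinetic_series c \<nu> \<mu> N\<^sub>0 t =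
     (\<Sum>k. N\<^sub>0 * (real k + 1) * (- (c powr \<nu>)) ^ k * normalized_power (\<nu> * real k + \<mu>) t)"

lemma kinetic_series_eq_mittag_leffler:
  assumes "\<nu> > 0" "\<mu> > 0" "t > 0"
  shows "kinetic_series c \<nu> \<mu> N\<^sub>0 t = N\<^sub>0 / \<nu> * t powr (\<mu> - 1) *
       (mittag_leffler \<nu> (\<mu> - 1) (- (c powr \<nu>) * t powr \<nu>)
        + (1 + \<nu> - \<mu>) * mittag_leffler \<nu> \<mu> (- (c powr \<nu>) * t powr \<nu>))"
proof -
  let ?z = "- (c powr \<nu>) * t powr \<nu>"
  have "kinetic_series c \<nu> \<mu> N\<^sub>0 t =
      (\<Sum>k. N\<^sub>0 * t powr (\<mu> - 1) * ((real k + 1) * (?z ^ k * rGamma (\<nu> * real k + \<mu>))))"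
    unfolding kinetic_series_def power_mult_distrib
    by (simp add: normalized_power_arith_progression[OF assms(3)] mult_ac)
  also have "\<dots> = N\<^sub>0 * t powr (\<mu> - 1) * (\<Sum>k. (real k + 1) * (?z ^ k * rGamma (\<nu> * real k + \<mu>)))"
    by (rule suminf_mult) (rule summable_rGamma_series[OF assms(1,2)])
  finally show ?thesis
    using assms by (simp add: mittag_leffler_combination del: mult_minus_left)
qed

text \<open>
  Subtracting the forcing term lowers the factor \<open>k + 1\<close> to \<open>k\<close>, while fractional integration of
  order \<open>\<nu>\<close> moves the \<open>k\<close>-th power to the \<open>(k + 1)\<close>-st.  So both sides are the same series up to a
  shift of the summation index.
\<close>
lemma kinetic_solution_series:
  fixes c \<nu> \<mu> N\<^sub>0 :: real and F :: "real \<Rightarrow> real"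
  assumes \<nu>: "\<nu> > 0" and \<mu>: "\<mu> > 0"
    and F: "\<And>t. t > 0 \<Longrightarrow> F t = kinetic_series c \<nu> \<mu> N\<^sub>0 t"
  shows "kinetic_solution c \<nu> \<mu> N\<^sub>0 F"
proof -
  define a where "a = c powr \<nu>"
  define b where "b k = N\<^sub>0 * (real k + 1) * (- a) ^ k" for k :: nat
  define p where "p k = \<nu> * real k + \<mu>" for k :: nat
  have a: "a \<ge> 0" by (simp add: a_def)
  have p: "p k > 0" for k using \<nu> \<mu> by (simp add: p_def add_nonneg_pos)
  have F': "F t = (\<Sum>k. b k * normalized_power (p k) t)" if "t > 0" for t
    using F[OF that] by (simp add: kinetic_series_def a_def b_def p_def)
  have summ: "summable (\<lambda>k. \<bar>b k\<bar> * normalized_power (p k + \<sigma>) t)" if "\<sigma> \<ge> 0" "t > 0" for \<sigma> t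
  proof -
    have "\<bar>b k\<bar> * normalized_power (p k + \<sigma>) t = \<bar>N\<^sub>0\<bar> * t powr (\<mu> + \<sigma> - 1) *
       ((real k + 1) * ((a * t powr \<nu>) ^ k * rGamma (\<nu> * real k + (\<mu> + \<sigma>))))" for k
      using normalized_power_arith_progression[OF that(2), of \<nu> k "\<mu> + \<sigma>"] a
      by (simp add: b_def p_def abs_mult power_abs power_mult_distrib add.assoc mult_ac)
    then show ?thesis
      using summable_mult[OF summable_rGamma_series(2)[OF \<nu>, of "\<mu> + \<sigma>" "a * t powr \<nu>"]] \<mu> that
      by simp
  qed
  have series: "rl_integrable \<sigma> F t"
      "(\<lambda>k. b k * normalized_power (p k + \<sigma>) t) sums rl_integral \<sigma> F t" if "\<sigma> > 0" "t > 0" for \<sigma> t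
    using rl_integral_sums[OF that, of p b F] p summ[of 0] summ[of \<sigma> t] F' that by simp_all
  have "set_integrable lebesgue {0..T} F" if "T > 0" for T
  proof -
    \<comment> \<open>For order 1 the kernel is 1, except at the endpoint where \<open>0 powr 0 = 0\<close>; integrating up to
      \<open>T + 1\<close> keeps that endpoint outside of \<open>[0, T]\<close>.\<close>
    have "set_integrable lebesgue {0..T + 1} (\<lambda>u. F u * (T + 1 - u) powr (1 - 1))"
      using series(1)[of 1 "T + 1"] that by (simp add: rl_integrable_def)
    then have "set_integrable lebesgue {0..T} (\<lambda>u. F u * (T + 1 - u) powr (1 - 1))"
      by (rule set_integrable_subset) (use that in auto)
    also have "?this \<longleftrightarrow> ?thesis"
      by (rule set_integrable_cong) auto
    finally show ?thesis .
  qed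
  moreover have "F t - N\<^sub>0 * t powr (\<mu> - 1) * mittag_leffler \<nu> \<mu> (- a * t powr \<nu>) = - a * rl_integral \<nu> F t"
    if t: "t > 0" for t
  proof -
    let ?e = "\<lambda>k. N\<^sub>0 * (- a) ^ k"
    have "summable (\<lambda>k. b k * normalized_power (p k) t)"
      by (rule summable_rabs_cancel)
        (use summ[of 0 t] t in \<open>simp add: abs_mult normalized_power_nonneg p\<close>)
    then have 1: "(\<lambda>k. b k * normalized_power (p k) t) sums F t"
      using F'[OF t] by (simp add: summable_sums)
    have "(\<lambda>k. N\<^sub>0 * t powr (\<mu> - 1) * ((- a * t powr \<nu>) ^ k * rGamma (\<nu> * real k + \<mu>)))
        sums (N\<^sub>0 * t powr (\<mu> - 1) * mittag_leffler \<nu> \<mu> (- a * t powr \<nu>))"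
      unfolding mittag_leffler_def by (intro sums_mult summable_sums summable_rGamma_series \<nu> \<mu>)
    also have "(\<lambda>k. N\<^sub>0 * t powr (\<mu> - 1) * ((- a * t powr \<nu>) ^ k * rGamma (\<nu> * real k + \<mu>)))
        = (\<lambda>k. ?e k * normalized_power (p k) t)"
      unfolding power_mult_distrib
      by (simp add: normalized_power_arith_progression[OF t] p_def mult_ac)
    finally have 2: "(\<lambda>k. ?e k * normalized_power (p k) t)
        sums (N\<^sub>0 * t powr (\<mu> - 1) * mittag_leffler \<nu> \<mu> (- a * t powr \<nu>))" .
    have "(\<lambda>k. - a * (b k * normalized_power (p k + \<nu>) t)) sums (- a * rl_integral \<nu> F t)"
      by (intro sums_mult series \<nu> t)
    also have "(\<lambda>k. - a * (b k * normalized_power (p k + \<nu>) t)) =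
        (\<lambda>k. b (Suc k) * normalized_power (p (Suc k)) t - ?e (Suc k) * normalized_power (p (Suc k)) t)"
      by (simp add: b_def p_def algebra_simps)
    \<comment> \<open>The term for \<open>k = 0\<close> vanishes, so it may be prepended to the shifted series.\<close>
    finally have "(\<lambda>k. b k * normalized_power (p k) t - ?e k * normalized_power (p k) t) sums (- a * rl_integral \<nu> F t)"
      by (subst (asm) sums_Suc_iff) (simp add: b_def)
    with sums_diff[OF 1 2] show ?thesis by (rule sums_unique2)
  qed
  ultimately show ?thesis
    using series(1)[OF \<nu>] by (simp add: kinetic_solution_def locally_integrable_nonneg_def a_def)
qed

lemma kinetic_solution_unique:
  assumes "c > 0" "\<nu> > 0"
    and M: "kinetic_solution c \<nu> \<mu> N\<^sub>0 M" and N: "kinetic_solution c \<nu> \<mu> N\<^sub>0 N" and "T > 0"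
  shows "M T = N T"
proof -
  let ?f = "\<lambda>t. M t - N t"
  note sol = M[unfolded kinetic_solution_def] N[unfolded kinetic_solution_def]
  have loc: "locally_integrable_nonneg ?f"
    using sol by (auto simp: locally_integrable_nonneg_def intro: set_integral_diff)
  have rl: "rl_integrable \<nu> ?f t \<and> rl_integral \<nu> ?f t = rl_integral \<nu> M t - rl_integral \<nu> N t" if "t > 0" for t
  proof -
    have "rl_integrable \<nu> M t" "rl_integrable \<nu> N t" using sol that by auto
    from set_integral_diff[OF this[unfolded rl_integrable_def]] show ?thesis
      by (simp add: rl_integrable_def rl_integral_def left_diff_distrib right_diff_distrib diff_divide_distrib)
  qed
  have eq: "?f t = - (c powr \<nu>) * rl_integral \<nu> ?f t" if "t > 0" for t
  proof -
    have "M t - N\<^sub>0 * t powr (\<mu> - 1) * mittag_leffler \<nu> \<mu> (- (c powr \<nu>) * t powr \<nu>) = - (c powr \<nu>) * rl_integral \<nu> M t"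
      "N t - N\<^sub>0 * t powr (\<mu> - 1) * mittag_leffler \<nu> \<mu> (- (c powr \<nu>) * t powr \<nu>) = - (c powr \<nu>) * rl_integral \<nu> N t"
      using sol that by blast+
    then show ?thesis using rl[OF that] by (simp add: right_diff_distrib)
  qed
  have "?f T = 0"
    by (rule volterra_unique[of "c powr \<nu>" \<nu>]) (use assms loc rl eq in auto)
  then show ?thesis by simp
qed

theorem theorem3:
  fixes c \<nu> \<mu> N\<^sub>0 :: real and N :: "real \<Rightarrow> real"
  assumes "c > 0" and "\<nu> > 0" and "\<mu> > 0"
  shows "kinetic_solution c \<nu> \<mu> N\<^sub>0 N \<longleftrightarrow>
    (\<forall>t>0. N t = N\<^sub>0 / \<nu> * t powr (\<mu> - 1) *
       (mittag_leffler \<nu> (\<mu> - 1) (- (c powr \<nu>) * t powr \<nu>)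
        + (1 + \<nu> - \<mu>) * mittag_leffler \<nu> \<mu> (- (c powr \<nu>) * t powr \<nu>)))"
proof -
  have "kinetic_solution c \<nu> \<mu> N\<^sub>0 N \<longleftrightarrow> (\<forall>t>0. N t = kinetic_series c \<nu> \<mu> N\<^sub>0 t)"
  proof
    assume N: "kinetic_solution c \<nu> \<mu> N\<^sub>0 N"
    have "kinetic_solution c \<nu> \<mu> N\<^sub>0 (kinetic_series c \<nu> \<mu> N\<^sub>0)"
      by (rule kinetic_solution_series[OF assms(2,3)]) simp
    then show "\<forall>t>0. N t = kinetic_series c \<nu> \<mu> N\<^sub>0 t"
      using kinetic_solution_unique[OF assms(1,2) N] by blast
  next
    assume "\<forall>t>0. N t = kinetic_series c \<nu> \<mu> N\<^sub>0 t"
    then show "kinetic_solution c \<nu> \<mu> N\<^sub>0 N"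
      by (intro kinetic_solution_series assms) simp
  qed
  then show ?thesis
    using kinetic_series_eq_mittag_leffler[OF assms(2,3)] by simp
qed

end
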